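(* For any real number $k \in (1,\infty)$, the limit $\rho(k) = \lim_{d\to\infty} \frac{r_d}{k^d}$ exists, where $(r_d)_{d\ge 0}$ is the row-length sequence of the $k$-descending tree. Thus $r_d \sim \rho(k)\cdot k^d$ as $d \to \infty$.
   Context: $\mathbb{N}$ denotes the non-negative integers. For real $k>1$, the $k$-descending tree (or $k$-tree) is the rooted tree with node set $\mathbb{N}$ and root $0$, in which every positive integer $n$ has parent $\lfloor n/k \rfloor$. For a node $n\in\mathbb{N}$, let $g_0 = n$ and $g_{i+1} = \lfloor g_i/k \rfloor$; then $\mathrm{depth}(n) = \min\{i \ge 0 : g_i = 0\}$, and $r_d = |\{n \in \mathbb{N} : \mathrm{depth}(n) = d\}|$ for $d \ge 0$ is the number of nodes at depth $d$. All of these depend on $k$. The notation $f(d)\sim g(d)$ means $\lim_{d\to\infty} f(d)/g(d) = 1$. *)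

theory Defs
  imports Complex_Main
begin

definition parent :: "real \<Rightarrow> nat \<Rightarrow> nat" where
  "parent k n = nat \<lfloor>real n / k\<rfloor>"

definition depth :: "real \<Rightarrow> nat \<Rightarrow> nat" where
  "depth k n = (LEAST i. (parent k ^^ i) n = 0)"

definition row_length :: "real \<Rightarrow> nat \<Rightarrow> nat" where
  "row_length k d = card {n. depth k n = d}"

(* Meaningful only if the limit exists. *)
definition rho :: "real \<Rightarrow> real" where
  "rho k = lim (\<lambda>d. real (row_length k d) / k ^ d)"

(* The next two lemmas show that, for k > 1, the LEAST in depth is attained
   and the cardinality in row_length is that of a finite set. *)

lemma depth_attained:
  assumes "k > 1"
  shows "(parent k ^^ depth k n) n = 0"
proof -
  have "\<exists>i. (parent k ^^ i) n = 0"
  proof (induction n rule: less_induct)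
    case (less n)
    show ?case
    proof (cases "n = 0")
      case True
      then show ?thesis by (intro exI[of _ 0]) simp
    next
      case False
      have "real n / k < real n"
        using False assms by (simp add: divide_simps)
      then have "parent k n < n"
        unfolding parent_def using False by linarith
      then obtain i where "(parent k ^^ i) (parent k n) = 0"
        using less.IH by blast
      then have "(parent k ^^ Suc i) n = 0"
        by (simp only: funpow_Suc_right comp_apply)
      then show ?thesis by blast
    qed
  qed
  then show ?thesis
    unfolding depth_def by (rule LeastI_ex)
qed

lemma finite_row:
  assumes "k > 1"
  shows "finite {n. depth k n = d}"
proof -
  have "finite {n. (parent k ^^ d) n = 0}"
  proof (induction d)
    case 0
    then show ?case by simp
  next
    case (Suc d)
    have fin: "finite {n. parent k n = m}" for m
    proof (rule finite_subset)
      show "{n. parent k n = m} \<subseteq> {..nat \<lceil>k * (real m + 1)\<rceil>}"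
      proof
        fix n assume "n \<in> {n. parent k n = m}"
        then have "real n / k < real m + 1"
          unfolding parent_def by simp linarith
        then have "real n < k * (real m + 1)"
          using assms by (simp add: divide_simps mult.commute)
        then show "n \<in> {..nat \<lceil>k * (real m + 1)\<rceil>}"
          by simp linarith
      qed
    qed simp
    have "{n. (parent k ^^ Suc d) n = 0}
            = (\<Union>m\<in>{m. (parent k ^^ d) m = 0}. {n. parent k n = m})"
      by (auto simp only: funpow_Suc_right comp_apply)
    then show ?case using Suc fin by simp
  qed
  moreover have "{n. depth k n = d} \<subseteq> {n. (parent k ^^ d) n = 0}"
    using depth_attained[OF assms] by auto
  ultimately show ?thesis by (rule rev_finite_subset)
qed

end

(* The nodes of depth at most d are exactly those below F_d, where F_0 = 1 and
   F_(d+1) is the ceiling of k F_d. Hence F_d / k^d increases, and since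
   F_(d+1) <= k F_d + 1 it is bounded, so it has a limit L >= 1. As row d + 1 has
   F_(d+1) - F_d elements, r_d / k^d tends to L (1 - 1/k) > 0. *)
theory Submission
  imports Defs
begin

text \<open>This is F_d; the iteration starts at 1 because 0 is the only node of depth 0.\<close>

definition row_bound :: "real \<Rightarrow> nat \<Rightarrow> nat" where
  "row_bound k d = ((\<lambda>m. nat \<lceil>k * real m\<rceil>) ^^ d) 1"

lemma row_bound_0 [simp]: "row_bound k 0 = 1"
  by (simp add: row_bound_def)

lemma row_bound_Suc: "row_bound k (Suc d) = nat \<lceil>k * real (row_bound k d)\<rceil>"
  by (simp add: row_bound_def)

lemma parent_less_iff:
  assumes "k > 0"
  shows "parent k n < m \<longleftrightarrow> n < nat \<lceil>k * real m\<rceil>"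
proof -
  have "parent k n < m \<longleftrightarrow> \<lfloor>real n / k\<rfloor> < int m"
    using assms unfolding parent_def by (simp add: nat_less_iff)
  also have "\<dots> \<longleftrightarrow> real n < k * real m"
    using assms by (simp add: floor_less_iff divide_simps mult.commute)
  also have "\<dots> \<longleftrightarrow> n < nat \<lceil>k * real m\<rceil>"
    by linarith
  finally show ?thesis .
qed

lemma funpow_parent_eq_0_iff:
  assumes "k > 0"
  shows "(parent k ^^ d) n = 0 \<longleftrightarrow> n < row_bound k d"
proof (induction d arbitrary: n)
  case (Suc d)
  have "(parent k ^^ Suc d) n = 0 \<longleftrightarrow> parent k n < row_bound k d"
    using Suc by (simp only: funpow_Suc_right comp_apply)
  then show ?case
    using parent_less_iff[OF assms] by (simp add: row_bound_Suc)
qed simp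

lemma row_bound_grows:
  assumes "k > 1"
  shows "k * real (row_bound k d) \<le> real (row_bound k (Suc d))"
    and "real (row_bound k (Suc d)) \<le> k * real (row_bound k d) + 1"
proof -
  \<comment> \<open>Nonnegativity keeps \<open>nat\<close> from truncating, so only the rounding
    error of the ceiling remains.\<close>
  have "0 \<le> k * real (row_bound k d)"
    using assms by simp
  then show "k * real (row_bound k d) \<le> real (row_bound k (Suc d))"
    and "real (row_bound k (Suc d)) \<le> k * real (row_bound k d) + 1"
    unfolding row_bound_Suc by linarith+
qed

lemma row_bound_mono:
  assumes "k > 1" "d \<le> e"
  shows "row_bound k d \<le> row_bound k e"
proof (rule lift_Suc_mono_le[OF _ assms(2)])
  fix n
  have "1 * real (row_bound k n) \<le> k * real (row_bound k n)"
    using assms(1) by (intro mult_right_mono) auto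
  then show "row_bound k n \<le> row_bound k (Suc n)"
    using row_bound_grows(1)[OF assms(1), of n] by linarith
qed

text \<open>Minimality in \<open>depth\<close> gives one direction. For the other, n lies below the
  bound at its own depth, and the bounds increase.\<close>

lemma depth_le_iff:
  assumes "k > 1"
  shows "depth k n \<le> d \<longleftrightarrow> n < row_bound k d"
proof
  assume "depth k n \<le> d"
  moreover have "n < row_bound k (depth k n)"
    using depth_attained[OF assms] funpow_parent_eq_0_iff assms by simp
  ultimately show "n < row_bound k d"
    using row_bound_mono[OF assms] less_le_trans by blast
next
  assume "n < row_bound k d"
  then show "depth k n \<le> d"
    using assms unfolding depth_def by (intro Least_le) (simp add: funpow_parent_eq_0_iff)
qed

lemma row_length_Suc:
  assumes "k > 1"
  shows "real (row_length k (Suc d)) = real (row_bound k (Suc d)) - real (row_bound k d)"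
proof -
  have "depth k n = Suc d \<longleftrightarrow> n \<in> {row_bound k d..<row_bound k (Suc d)}" for n
    using depth_le_iff[OF assms, of n d] depth_le_iff[OF assms, of n "Suc d"] by auto
  then have "{n. depth k n = Suc d} = {row_bound k d..<row_bound k (Suc d)}"
    by blast
  \<comment> \<open>The cardinality is a truncated difference of naturals; monotonicity makes it
    agree with the real one.\<close>
  then show ?thesis
    using row_bound_mono[OF assms, of d "Suc d"] by (simp add: row_length_def of_nat_diff)
qed

lemma row_bound_limit:
  assumes "k > 1"
  obtains L where "L \<ge> 1" "(\<lambda>d. real (row_bound k d) / k ^ d) \<longlonglongrightarrow> L"
proof -
  let ?F = "\<lambda>d. real (row_bound k d)"
  \<comment> \<open>The shift c solves \<open>1 + c = k * c\<close>, which turns F_(d+1) \<le> k F_d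
    + 1 into the geometric recursion F_(d+1) + c \<le> k (F_d + c).\<close>
  define c where "c = 1 / (k - 1)"
  have c: "c \<ge> 0" "1 + c = k * c"
    using assms by (auto simp: c_def field_simps)
  have bound: "?F d + c \<le> (1 + c) * k ^ d" for d
  proof (induction d)
    case (Suc d)
    have "?F (Suc d) + c \<le> k * (?F d + c)"
      using row_bound_grows(2)[OF assms, of d] c by (simp add: algebra_simps)
    also have "\<dots> \<le> k * ((1 + c) * k ^ d)"
      using Suc assms by (intro mult_left_mono) auto
    finally show ?case
      by (simp add: mult_ac)
  qed simp
  have "?F d / k ^ d \<le> ?F (Suc d) / k ^ Suc d" for d
    using row_bound_grows(1)[OF assms, of d] assms by (simp add: field_simps)
  then have inc: "incseq (\<lambda>d. ?F d / k ^ d)"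
    by (rule incseq_SucI)
  have "?F d / k ^ d \<le> 1 + c" for d
    using bound[of d] c assms by (simp add: divide_le_eq)
  then have "\<forall>d. ?F d / k ^ d \<le> 1 + c"
    by blast
  from incseq_convergent[OF inc this]
  obtain L where L: "(\<lambda>d. ?F d / k ^ d) \<longlonglongrightarrow> L" "\<forall>d. ?F d / k ^ d \<le> L"
    by blast
  \<comment> \<open>The limit of an increasing sequence dominates its term at 0, which is 1.\<close>
  have "L \<ge> 1"
    using spec[OF L(2), of 0] by simp
  then show ?thesis
    using L(1) by (rule that)
qed

text \<open>Positivity is recorded because the asymptotic statement divides by the limit, and
  division by 0 yields 0.\<close>

lemma row_length_limit:
  assumes "k > 1"
  obtains R where "R > 0" "(\<lambda>d. real (row_length k d) / k ^ d) \<longlonglongrightarrow> R"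
proof -
  let ?F = "\<lambda>d. real (row_bound k d)"
  obtain L where L: "L \<ge> 1" "(\<lambda>d. ?F d / k ^ d) \<longlonglongrightarrow> L"
    using row_bound_limit[OF assms] .
  have "(\<lambda>d. ?F (Suc d) / k ^ Suc d - ?F d / k ^ d / k) \<longlonglongrightarrow> L - L / k"
    using L(2) assms by (intro tendsto_diff tendsto_divide tendsto_const LIMSEQ_Suc) auto
  moreover have "real (row_length k (Suc d)) / k ^ Suc d = ?F (Suc d) / k ^ Suc d - ?F d / k ^ d / k"
    for d
    by (simp add: row_length_Suc[OF assms] diff_divide_distrib mult.commute)
  ultimately have "(\<lambda>d. real (row_length k (Suc d)) / k ^ Suc d) \<longlonglongrightarrow> L - L / k"
    by simp
  \<comment> \<open>Row 0 lies outside the difference formula, but a shift of the index does not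
    affect the limit.\<close>
  then have "(\<lambda>d. real (row_length k d) / k ^ d) \<longlonglongrightarrow> L - L / k"
    by (rule LIMSEQ_imp_Suc)
  moreover have "L - L / k > 0"
    using L(1) assms by (simp add: field_simps)
  ultimately show ?thesis
    using that by blast
qed

theorem theorem1:
  fixes k :: real
  assumes "k > 1"
  shows "convergent (\<lambda>d. real (row_length k d) / k ^ d) \<and>
         (\<lambda>d. real (row_length k d) / (rho k * k ^ d)) \<longlonglongrightarrow> 1"
proof -
  obtain R where R: "R > 0" "(\<lambda>d. real (row_length k d) / k ^ d) \<longlonglongrightarrow> R"
    using row_length_limit[OF assms] .
  \<comment> \<open>Limits are unique, so \<open>lim\<close> in \<open>rho\<close> returns
    R.\<close>
  then have "rho k = R"
    unfolding rho_def by (intro limI)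
  moreover have "(\<lambda>d. real (row_length k d) / k ^ d / R) \<longlonglongrightarrow> R / R"
    using R by (intro tendsto_divide tendsto_const) auto
  ultimately show ?thesis
    using R by (auto simp: convergent_def mult.commute)
qed

end
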